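(* (i) If $r=\min(m,n)$, then $D_r^J=\{X\in P:\operatorname{rank}(X)=r\}$ is the unique maximal $\mathcal D^J$-class of $\mathcal M_{mn}^J$, and is a subsemigroup of $\mathcal M_{mn}^J$. (ii) If $r<\min(m,n)$, then the maximal $\mathcal D^J$-classes of $\mathcal M_{mn}^J$ are those of the form $D_X^J=\{X\}$ with $\operatorname{rank}(X)>r$.
   Context: Let $\mathbb F$ be a field, $m,n\geq1$ integers, and $0\leq r\leq\min(m,n)$. $\mathcal M_{kl}$ denotes the set of all $k\times l$ matrices over $\mathbb F$. Let $J=\begin{bmatrix}I_r&O\\O&O\end{bmatrix}\in\mathcal M_{nm}$ (an $n\times m$ matrix), and let $\mathcal M_{mn}^J$ be the semigroup with underlying set $\mathcal M_{mn}$ and operation $X\star Y=XJY$. $P=\operatorname{Reg}(\mathcal M_{mn}^J)$ is the set of all regular elements of $\mathcal M_{mn}^J$ (those $X$ with $X=X\star Y\star X$ for some $Y$); equivalently $P=\{X\in\mathcal M_{mn}:\operatorname{rank}(JXJ)=\operatorname{rank}(X)\}$. $\mathcal D^J$ and $\mathcal J^J$ are the usual Green's relations of $\mathcal M_{mn}^J$ (in this semigroup $\mathcal D^J=\mathcal J^J$), and $D_X^J$ is the $\mathcal D^J$-class of $X$. Maximality is with respect to the usual partial order on $\mathcal D^J=\mathcal J^J$-classes: $D_X^J\leq D_Y^J$ iff $X=Y$, or $X=U\star Y$, or $X=Y\star V$, or $X=U\star Y\star V$ for some $U,V\in\mathcal M_{mn}$. *)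

theory Defs
  imports Jordan_Normal_Form.DL_Rank
begin

section \<open>Green's relations of a semigroup given by a carrier set and an operation\<close>

text \<open>
  A semigroup is represented by a carrier set \<open>S\<close> and a binary operation \<open>f\<close>; closure of \<open>S\<close> under
  \<open>f\<close> and associativity on \<open>S\<close> are not built into the definitions below (for the matrix semigroup
  they are proved at the end of this theory). The sets \<open>{x} \<union> S x\<close> and \<open>{x} \<union> x S\<close> are the principal
  one-sided ideals generated by \<open>x\<close>.
\<close>

definition green_L :: "'s set \<Rightarrow> ('s \<Rightarrow> 's \<Rightarrow> 's) \<Rightarrow> ('s \<times> 's) set" where
  "green_L S f = {(x, y) \<in> S \<times> S. insert x {f u x | u. u \<in> S} = insert y {f u y | u. u \<in> S}}"

definition green_R :: "'s set \<Rightarrow> ('s \<Rightarrow> 's \<Rightarrow> 's) \<Rightarrow> ('s \<times> 's) set" where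
  "green_R S f = {(x, y) \<in> S \<times> S. insert x {f x v | v. v \<in> S} = insert y {f y v | v. v \<in> S}}"

definition green_D :: "'s set \<Rightarrow> ('s \<Rightarrow> 's \<Rightarrow> 's) \<Rightarrow> ('s \<times> 's) set" where
  "green_D S f = green_L S f O green_R S f"

definition D_class :: "'s set \<Rightarrow> ('s \<Rightarrow> 's \<Rightarrow> 's) \<Rightarrow> 's \<Rightarrow> 's set" where
  "D_class S f x = green_D S f `` {x}"

definition below :: "'s set \<Rightarrow> ('s \<Rightarrow> 's \<Rightarrow> 's) \<Rightarrow> 's \<Rightarrow> 's \<Rightarrow> bool" where
  "below S f x y \<longleftrightarrow> x = y \<or> (\<exists>u\<in>S. x = f u y) \<or> (\<exists>v\<in>S. x = f y v)
     \<or> (\<exists>u\<in>S. \<exists>v\<in>S. x = f (f u y) v)"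

text \<open>
  The order on \<open>\<D>\<close>-classes induced by \<^const>\<open>below\<close>. By lemma \<open>D_class_le_iff\<close> below it does not depend
  on the chosen representatives.
\<close>

definition D_class_le :: "'s set \<Rightarrow> ('s \<Rightarrow> 's \<Rightarrow> 's) \<Rightarrow> 's set \<Rightarrow> 's set \<Rightarrow> bool" where
  "D_class_le S f C C' \<longleftrightarrow> (\<exists>x\<in>C. \<exists>y\<in>C'. below S f x y)"

definition maximal_D_class :: "'s set \<Rightarrow> ('s \<Rightarrow> 's \<Rightarrow> 's) \<Rightarrow> 's set \<Rightarrow> bool" where
  "maximal_D_class S f C \<longleftrightarrow> C \<in> S // green_D S f \<and>
     (\<forall>C' \<in> S // green_D S f. D_class_le S f C C' \<longrightarrow> C' = C)"

definition Reg :: "'s set \<Rightarrow> ('s \<Rightarrow> 's \<Rightarrow> 's) \<Rightarrow> 's set" where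
  "Reg S f = {x \<in> S. \<exists>y\<in>S. x = f (f x y) x}"

definition subsemigroup :: "'s set \<Rightarrow> ('s \<Rightarrow> 's \<Rightarrow> 's) \<Rightarrow> 's set \<Rightarrow> bool" where
  "subsemigroup S f T \<longleftrightarrow> T \<noteq> {} \<and> T \<subseteq> S \<and> (\<forall>x\<in>T. \<forall>y\<in>T. f x y \<in> T)"

lemma below_trans:
  assumes cl: "\<And>x y. x \<in> S \<Longrightarrow> y \<in> S \<Longrightarrow> f x y \<in> S"
    and as: "\<And>x y z. x \<in> S \<Longrightarrow> y \<in> S \<Longrightarrow> z \<in> S \<Longrightarrow> f (f x y) z = f x (f y z)"
    and S: "z \<in> S" and xy: "below S f x y" and yz: "below S f y z"
  shows "below S f x z"
  using xy yz S unfolding below_def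
  by (elim disjE bexE) (simp_all add: as cl, (metis as cl)+)

lemma D_class_le_iff:
  assumes cl: "\<And>x y. x \<in> S \<Longrightarrow> y \<in> S \<Longrightarrow> f x y \<in> S"
    and as: "\<And>x y z. x \<in> S \<Longrightarrow> y \<in> S \<Longrightarrow> z \<in> S \<Longrightarrow> f (f x y) z = f x (f y z)"
    and S: "x \<in> S" "y \<in> S"
  shows "D_class_le S f (D_class S f x) (D_class S f y) \<longleftrightarrow> below S f x y"
proof -
  have L: "below S f a b \<and> below S f b a" if "(a, b) \<in> green_L S f" for a b
  proof -
    have "insert a {f u a | u. u \<in> S} = insert b {f u b | u. u \<in> S}"
      using that by (auto simp: green_L_def)
    then have "a \<in> insert b {f u b | u. u \<in> S}" "b \<in> insert a {f u a | u. u \<in> S}" by blast+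
    then show ?thesis by (auto simp: below_def)
  qed
  have R: "below S f a b \<and> below S f b a" if "(a, b) \<in> green_R S f" for a b
  proof -
    have "insert a {f a u | u. u \<in> S} = insert b {f b u | u. u \<in> S}"
      using that by (auto simp: green_R_def)
    then have "a \<in> insert b {f b u | u. u \<in> S}" "b \<in> insert a {f a u | u. u \<in> S}" by blast+
    then show ?thesis by (auto simp: below_def)
  qed
  have D: "below S f a b \<and> below S f b a \<and> a \<in> S \<and> b \<in> S" if ab: "(a, b) \<in> green_D S f" for a b
  proof -
    obtain c where c: "(a, c) \<in> green_L S f" "(c, b) \<in> green_R S f"
      using ab by (auto simp: green_D_def)
    then have "a \<in> S" "b \<in> S" by (auto simp: green_L_def green_R_def)
    then show ?thesis using L[OF c(1)] R[OF c(2)] below_trans[of S f, OF cl as] by blast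
  qed
  have refl: "a \<in> D_class S f a" if "a \<in> S" for a
    using that by (auto simp: D_class_def green_D_def green_L_def green_R_def)
  show ?thesis
  proof
    assume "D_class_le S f (D_class S f x) (D_class S f y)"
    then obtain a b where "(x, a) \<in> green_D S f" "(y, b) \<in> green_D S f" "below S f a b"
      by (auto simp: D_class_le_def D_class_def)
    then show "below S f x y" using D[of x a] D[of y b] below_trans[of S f, OF cl as] by blast
  next
    assume "below S f x y"
    then show "D_class_le S f (D_class S f x) (D_class S f y)"
      using refl S by (auto simp: D_class_le_def)
  qed
qed

section \<open>The sandwich semigroup of rectangular matrices\<close>

definition J_mat :: "nat \<Rightarrow> nat \<Rightarrow> nat \<Rightarrow> 'a::field mat" where
  "J_mat n m r = four_block_mat (1\<^sub>m r) (0\<^sub>m r (m - r)) (0\<^sub>m (n - r) r) (0\<^sub>m (n - r) (m - r))"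

definition star :: "nat \<Rightarrow> nat \<Rightarrow> nat \<Rightarrow> 'a::field mat \<Rightarrow> 'a mat \<Rightarrow> 'a mat" where
  "star m n r X Y = X * J_mat n m r * Y"

lemma J_mat_carrier: "r \<le> min m n \<Longrightarrow> J_mat n m r \<in> carrier_mat n m"
  by (auto simp: J_mat_def)

lemma star_closed:
  "X \<in> carrier_mat m n \<Longrightarrow> Y \<in> carrier_mat m n \<Longrightarrow> star m n r X Y \<in> carrier_mat m n"
  by (auto simp: star_def)

lemma star_assoc:
  fixes X Y Z :: "'a::field mat"
  assumes "r \<le> min m n" "X \<in> carrier_mat m n" "Y \<in> carrier_mat m n" "Z \<in> carrier_mat m n"
  shows "star m n r (star m n r X Y) Z = star m n r X (star m n r Y Z)"
proof -
  let ?J = "J_mat n m r :: 'a mat"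
  have J: "?J \<in> carrier_mat n m" by (rule J_mat_carrier[OF assms(1)])
  have XJ: "X * ?J \<in> carrier_mat m m" and YJ: "Y * ?J \<in> carrier_mat m m"
    using J assms by auto
  have "X * ?J * Y * ?J * Z = X * ?J * (Y * ?J) * Z"
    using assoc_mult_mat[OF XJ assms(3) J] by simp
  also have "\<dots> = X * ?J * (Y * ?J * Z)"
    by (rule assoc_mult_mat[OF XJ YJ assms(4)])
  finally show ?thesis by (simp add: star_def)
qed

end

theory Submission
  imports Defs
begin

text \<open>
  Write \<open>E\<close> for the transpose of \<open>J\<close>. If \<open>r = m\<close>, then \<open>E J\<close> is the identity matrix, so \<open>E\<close> is a left
  identity of the sandwich semigroup and every class lies below that of \<open>E\<close>; the elements above \<open>E\<close>
  are those \<open>X\<close> for which the square matrix \<open>X J\<close> is invertible, and these are mutually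
  \<open>\<D>\<close>-related and closed under products. The case \<open>r = n\<close> is the same argument in the opposite
  semigroup. If \<open>r < min m n\<close>, then every product has rank at most \<open>r\<close>, so a matrix of larger rank is
  below itself only. A matrix of rank at most \<open>r\<close> is \<open>A B\<close> with inner dimension \<open>r\<close>, hence of the
  form \<open>U J Y J V\<close> with \<open>Y\<close> the partial identity of rank \<open>r + 1\<close>, and its class is not maximal.
\<close>

section \<open>Maximal classes of a semigroup\<close>

text \<open>Collects the closure and associativity that the definitions of Green's relations leave
  open. The operation is arbitrary, so the reversed product can serve as a second instance.\<close>

locale semigroup_on =
  fixes S :: "'s set" and f :: "'s \<Rightarrow> 's \<Rightarrow> 's" (infixl "\<star>" 70)
  assumes closed: "x \<in> S \<Longrightarrow> y \<in> S \<Longrightarrow> x \<star> y \<in> S"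
    and assoc: "x \<in> S \<Longrightarrow> y \<in> S \<Longrightarrow> z \<in> S \<Longrightarrow> x \<star> y \<star> z = x \<star> (y \<star> z)"
begin

lemma below_refl: "below S f x x"
  by (simp add: below_def)

lemma below_transitive: "below S f x y \<Longrightarrow> below S f y z \<Longrightarrow> z \<in> S \<Longrightarrow> below S f x z"
  using below_trans[of S f z x y] closed assoc by blast

text \<open>If \<open>a = w \<star> b\<close>, associativity puts all left multiples of
  \<open>a\<close> among those of \<open>b\<close>, so equality of principal ideals becomes mutual
  divisibility. Equality is a separate case because \<open>x\<close> need not be a left multiple of
  itself.\<close>

lemma green_L_iff:
  "(x, y) \<in> green_L S f \<longleftrightarrow>
     x \<in> S \<and> y \<in> S \<and> (x = y \<or> (\<exists>u\<in>S. x = u \<star> y) \<and> (\<exists>u\<in>S. y = u \<star> x))"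
proof -
  have sub: "insert a {u \<star> a | u. u \<in> S} \<subseteq> insert b {u \<star> b | u. u \<in> S}"
    if "w \<in> S" "b \<in> S" "a = w \<star> b" for a b w
    using that by (auto simp: assoc[symmetric] intro: closed)
  show ?thesis
  proof (cases "x \<in> S \<and> y \<in> S \<and> x \<noteq> y")
    case True
    have "insert x {u \<star> x | u. u \<in> S} = insert y {u \<star> y | u. u \<in> S} \<longleftrightarrow>
        (\<exists>u\<in>S. x = u \<star> y) \<and> (\<exists>u\<in>S. y = u \<star> x)" (is "?X = ?Y \<longleftrightarrow> _")
    proof
      assume "?X = ?Y"
      then have "x \<in> ?Y" "y \<in> ?X" by blast+
      then show "(\<exists>u\<in>S. x = u \<star> y) \<and> (\<exists>u\<in>S. y = u \<star> x)"
        using True by auto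
    next
      assume "(\<exists>u\<in>S. x = u \<star> y) \<and> (\<exists>u\<in>S. y = u \<star> x)"
      then obtain u v where u: "u \<in> S" "x = u \<star> y" and v: "v \<in> S" "y = v \<star> x" by blast
      then show "?X = ?Y"
        using subset_antisym[OF sub[OF u(1) _ u(2)] sub[OF v(1) _ v(2)]] True by blast
    qed
    then show ?thesis using True by (simp add: green_L_def)
  qed (auto simp: green_L_def)
qed

lemma green_R_iff:
  "(x, y) \<in> green_R S f \<longleftrightarrow>
     x \<in> S \<and> y \<in> S \<and> (x = y \<or> (\<exists>v\<in>S. x = y \<star> v) \<and> (\<exists>v\<in>S. y = x \<star> v))"
proof -
  have sub: "insert a {a \<star> u | u. u \<in> S} \<subseteq> insert b {b \<star> u | u. u \<in> S}"
    if "w \<in> S" "b \<in> S" "a = b \<star> w" for a b w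
    using that by (auto simp: assoc intro: closed)
  show ?thesis
  proof (cases "x \<in> S \<and> y \<in> S \<and> x \<noteq> y")
    case True
    have "insert x {x \<star> u | u. u \<in> S} = insert y {y \<star> u | u. u \<in> S} \<longleftrightarrow>
        (\<exists>u\<in>S. x = y \<star> u) \<and> (\<exists>u\<in>S. y = x \<star> u)" (is "?X = ?Y \<longleftrightarrow> _")
    proof
      assume "?X = ?Y"
      then have "x \<in> ?Y" "y \<in> ?X" by blast+
      then show "(\<exists>u\<in>S. x = y \<star> u) \<and> (\<exists>u\<in>S. y = x \<star> u)"
        using True by auto
    next
      assume "(\<exists>u\<in>S. x = y \<star> u) \<and> (\<exists>u\<in>S. y = x \<star> u)"
      then obtain u v where u: "u \<in> S" "x = y \<star> u" and v: "v \<in> S" "y = x \<star> v" by blast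
      then show "?X = ?Y"
        using subset_antisym[OF sub[OF u(1) _ u(2)] sub[OF v(1) _ v(2)]] True by blast
    qed
    then show ?thesis using True by (simp add: green_R_def)
  qed (auto simp: green_R_def)
qed

lemma green_L_sym: "(x, y) \<in> green_L S f \<Longrightarrow> (y, x) \<in> green_L S f"
  by (auto simp: green_L_def)

lemma green_R_sym: "(x, y) \<in> green_R S f \<Longrightarrow> (y, x) \<in> green_R S f"
  by (auto simp: green_R_def)

lemma green_D_refl: "x \<in> S \<Longrightarrow> (x, x) \<in> green_D S f"
  unfolding green_D_def by (rule relcompI[of _ x]) (auto simp: green_L_iff green_R_iff)

text \<open>The inclusion of \<D> in \<J>: elements related by \<L> or by \<R> divide each other,
  and \<open>below\<close> is transitive.\<close>

lemma green_D_imp_below: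
  assumes "(x, y) \<in> green_D S f"
  shows "below S f x y" "below S f y x" "x \<in> S" "y \<in> S"
proof -
  obtain z where z: "(x, z) \<in> green_L S f" "(z, y) \<in> green_R S f"
    using assms by (auto simp: green_D_def)
  show S: "x \<in> S" "y \<in> S" using z by (auto simp: green_L_def green_R_def)
  have "z \<in> S" using z by (auto simp: green_L_def)
  moreover have "below S f x z" "below S f z x" "below S f z y" "below S f y z"
    using z unfolding green_L_iff green_R_iff below_def by blast+
  ultimately show "below S f x y" "below S f y x"
    using S below_transitive by blast+
qed

text \<open>By \<open>D_class_le_iff\<close> the order on classes can be tested on any
  representatives, which reduces maximality to a condition on \<open>below\<close>.\<close>

lemma maximal_iff:
  "maximal_D_class S f C \<longleftrightarrow> (\<exists>x\<in>S. C = D_class S f x \<and>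
     (\<forall>y\<in>S. below S f x y \<longrightarrow> D_class S f y = D_class S f x))"
proof -
  have le: "D_class_le S f (D_class S f x) (D_class S f y) \<longleftrightarrow> below S f x y"
    if "x \<in> S" "y \<in> S" for x y
    using D_class_le_iff[of S f x y] closed assoc that by blast
  have quot: "S // green_D S f = D_class S f ` S"
    by (auto simp: quotient_def D_class_def)
  show ?thesis
  proof
    assume max: "maximal_D_class S f C"
    then obtain x where x: "x \<in> S" "C = D_class S f x"
      unfolding maximal_D_class_def quot by blast
    have "D_class S f y = D_class S f x" if "y \<in> S" "below S f x y" for y
      using max x(1) that le[of x y] unfolding maximal_D_class_def quot x(2) by simp
    then show "\<exists>x\<in>S. C = D_class S f x \<and>
        (\<forall>y\<in>S. below S f x y \<longrightarrow> D_class S f y = D_class S f x)"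
      using x by blast
  next
    assume "\<exists>x\<in>S. C = D_class S f x \<and>
      (\<forall>y\<in>S. below S f x y \<longrightarrow> D_class S f y = D_class S f x)"
    then show "maximal_D_class S f C"
      unfolding maximal_D_class_def quot by (elim bexE conjE) (simp add: le)
  qed
qed

text \<open>The principal filter of \<open>e\<close>; when everything lies below \<open>e\<close>,
  this is the \<J>-class of \<open>e\<close>.\<close>

definition up :: "'s \<Rightarrow> 's set" where
  "up e = {x \<in> S. below S f e x}"

text \<open>Elements \<D>-related to a member of \<open>up e\<close> stay in \<open>up e\<close>,
  and by \<open>rel\<close> its members are all related, so \<open>up e\<close> is a single
  class.\<close>

lemma unique_maximal_D_class:
  assumes e: "e \<in> S" and top: "\<And>x. x \<in> S \<Longrightarrow> below S f x e"
    and rel: "\<And>x y. x \<in> up e \<Longrightarrow> y \<in> up e \<Longrightarrow> (x, y) \<in> green_D S f"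
  shows "{C. maximal_D_class S f C} = {up e}"
proof -
  have cls: "D_class S f x = up e" if "x \<in> up e" for x
  proof -
    have "y \<in> up e" if y: "(x, y) \<in> green_D S f" for y
      using green_D_imp_below[OF y] \<open>x \<in> up e\<close> below_transitive[of e x y]
      by (auto simp: up_def)
    then show ?thesis using rel[OF that] by (auto simp: D_class_def)
  qed
  have e_up: "e \<in> up e" using e by (simp add: up_def below_refl)
  have "C = up e" if C: "maximal_D_class S f C" for C
  proof -
    obtain x where "x \<in> S" "C = D_class S f x"
      "\<forall>y\<in>S. below S f x y \<longrightarrow> D_class S f y = D_class S f x"
      using C unfolding maximal_iff by blast
    \<comment> \<open>The class of the top element \<open>e\<close> lies above \<open>C\<close>, so
      maximality identifies the two.\<close>
    then have "D_class S f e = C" using top e by blast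
    then show ?thesis using cls[OF e_up] by simp
  qed
  moreover have "maximal_D_class S f (up e)"
  proof -
    have "D_class S f y = D_class S f e" if "y \<in> S" "below S f e y" for y
      using cls[of y] cls[OF e_up] that by (simp add: up_def)
    then show ?thesis unfolding maximal_iff using e cls[OF e_up] by blast
  qed
  ultimately show ?thesis by blast
qed

lemma D_class_eq_singleton:
  assumes "x \<in> S" and "\<And>y. y \<in> S \<Longrightarrow> below S f x y \<Longrightarrow> y = x"
  shows "D_class S f x = {x}"
  using assms green_D_imp_below green_D_refl by (force simp: D_class_def)

lemma maximal_D_class_of_singleton:
  assumes "x \<in> S" and "\<And>y. y \<in> S \<Longrightarrow> below S f x y \<Longrightarrow> y = x"
  shows "maximal_D_class S f (D_class S f x)"
  using assms by (auto simp: maximal_iff)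

lemma below_of_maximal:
  assumes "maximal_D_class S f (D_class S f x)" "x \<in> S" "y \<in> S" "below S f x y"
  shows "below S f y x"
proof -
  \<comment> \<open>The representative \<open>z\<close> given by \<open>maximal_iff\<close> may
    differ from \<open>x\<close>; since \<open>x\<close> belongs to the class of \<open>z\<close>,
    the order still passes from \<open>z\<close> through \<open>x\<close> to
    \<open>y\<close>.\<close>
  obtain z where z: "z \<in> S" "D_class S f x = D_class S f z"
    "\<forall>y\<in>S. below S f z y \<longrightarrow> D_class S f y = D_class S f z"
    using assms(1) by (auto simp: maximal_iff)
  have "(z, x) \<in> green_D S f"
    using z(2) green_D_refl[OF assms(2)] by (auto simp: D_class_def)
  then have "below S f z x" by (rule green_D_imp_below)
  then have "below S f z y" using assms below_transitive by blast
  then have "D_class S f y = D_class S f x" using z assms by auto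
  then have "(y, x) \<in> green_D S f"
    using green_D_refl[OF assms(2)] by (auto simp: D_class_def)
  then show ?thesis by (rule green_D_imp_below)
qed

lemma opposite: "semigroup_on S (\<lambda>x y. y \<star> x)"
  by unfold_locales (auto simp: closed assoc)

lemma below_opposite: "y \<in> S \<Longrightarrow> below S (\<lambda>x y. y \<star> x) x y \<longleftrightarrow> below S f x y"
  unfolding below_def by (auto simp: assoc)

lemma Reg_opposite: "Reg S (\<lambda>x y. y \<star> x) = Reg S f"
  unfolding Reg_def by (auto simp: assoc)

text \<open>Reversal swaps \<L> and \<R>, so their composition appears in the other order; symmetry
  of both turns it into the converse of \<open>green_D\<close>, whence the swapped pair.\<close>

lemma green_D_opposite: "(x, y) \<in> green_D S (\<lambda>x y. y \<star> x) \<longleftrightarrow> (y, x) \<in> green_D S f"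
proof -
  have "green_L S (\<lambda>x y. y \<star> x) = green_R S f" "green_R S (\<lambda>x y. y \<star> x) = green_L S f"
    by (auto simp: green_L_def green_R_def)
  then show ?thesis
    unfolding green_D_def relcomp_unfold by (simp, metis green_L_sym green_R_sym)
qed

end

text \<open>
  When \<open>e\<close> is a left identity, \<open>S \<star> e\<close> is a monoid with identity \<open>e\<close>. If its one-sided inverses
  are two-sided, then the elements above \<open>e\<close> are those \<open>x\<close> for which \<open>x \<star> e\<close> is a unit.
\<close>

locale left_identity_semigroup = semigroup_on +
  fixes e :: 'a
  assumes e_closed: "e \<in> S"
    and left_identity: "x \<in> S \<Longrightarrow> e \<star> x = x"
    and inverse_two_sided: "a \<in> S \<Longrightarrow> b \<in> S \<Longrightarrow> a \<star> e \<star> (b \<star> e) = e \<Longrightarrow> b \<star> e \<star> (a \<star> e) = e"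
begin

lemma below_left_identity: "x \<in> S \<Longrightarrow> below S f x e"
  using left_identity[of x] unfolding below_def by metis

text \<open>The witness \<open>a\<close> is the inverse of \<open>x \<star> e\<close> in the monoid
  \<open>S \<star> e\<close>. From \<open>e = u \<star> x \<star> v\<close> it is
  \<open>v \<star> u \<star> e\<close>: one use of \<open>inverse_two_sided\<close> moves
  \<open>u\<close> to the right end, a second makes the inverse two-sided.\<close>

lemma up_iff:
  "x \<in> up e \<longleftrightarrow> x \<in> S \<and> (\<exists>a\<in>S. a \<star> e = a \<and> a \<star> (x \<star> e) = e \<and> x \<star> a = e)"
proof
  assume "x \<in> up e"
  then have x: "x \<in> S" and "below S f e x" by (auto simp: up_def)
  \<comment> \<open>Factors missing in a case of \<open>below\<close> are filled with
    \<open>e\<close>, using that \<open>e\<close> is an idempotent left identity.\<close>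
  then obtain u v where uv: "u \<in> S" "v \<in> S" "e = u \<star> x \<star> v"
    unfolding below_def by (metis closed e_closed left_identity)
  have "u \<star> e \<star> (x \<star> v \<star> e) = u \<star> x \<star> v \<star> e"
    using uv(1,2) x by (simp add: assoc closed e_closed left_identity)
  then have "u \<star> e \<star> (x \<star> v \<star> e) = e"
    using uv(3) left_identity[OF e_closed] by simp
  then have "x \<star> v \<star> e \<star> (u \<star> e) = e"
    using inverse_two_sided[of u "x \<star> v"] uv x closed by blast
  then have right: "x \<star> e \<star> (v \<star> u \<star> e) = e"
    using uv(1,2) x by (simp add: assoc closed e_closed left_identity)
  then have "v \<star> u \<star> e \<star> (x \<star> e) = e"
    using inverse_two_sided[of x "v \<star> u"] uv x closed by blast
  moreover have "x \<star> (v \<star> u \<star> e) = e"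
    using right uv(1,2) x by (simp add: assoc closed e_closed left_identity)
  moreover have "v \<star> u \<star> e \<star> e = v \<star> u \<star> e"
    using uv(1,2) by (simp add: assoc closed e_closed left_identity)
  ultimately show "x \<in> S \<and> (\<exists>a\<in>S. a \<star> e = a \<and> a \<star> (x \<star> e) = e \<and> x \<star> a = e)"
    using x uv closed e_closed by blast
next
  assume "x \<in> S \<and> (\<exists>a\<in>S. a \<star> e = a \<and> a \<star> (x \<star> e) = e \<and> x \<star> a = e)"
  then show "x \<in> up e" by (auto simp: up_def below_def)
qed

lemma up_regular: "up e \<subseteq> Reg S f"
proof
  fix x assume "x \<in> up e"
  then obtain a where "x \<in> S" "a \<in> S" "x \<star> a = e" unfolding up_iff by blast
  then have "x = x \<star> a \<star> x" using left_identity by simp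
  then show "x \<in> Reg S f" using \<open>x \<in> S\<close> \<open>a \<in> S\<close> unfolding Reg_def by blast
qed

text \<open>Right inverses compose in reverse order: in
  \<open>x \<star> y \<star> (b \<star> a)\<close> the inner \<open>y \<star> b\<close> collapses to
  \<open>e\<close>, then \<open>x \<star> a\<close> does.\<close>

lemma up_closed: "x \<in> up e \<Longrightarrow> y \<in> up e \<Longrightarrow> x \<star> y \<in> up e"
proof -
  assume x: "x \<in> up e" and y: "y \<in> up e"
  obtain a b where ab: "a \<in> S" "b \<in> S" "x \<star> a = e" "y \<star> b = e"
    using x y unfolding up_iff by blast
  have S: "x \<in> S" "y \<in> S" using x y by (auto simp: up_iff)
  have "x \<star> y \<star> (b \<star> a) = x \<star> (y \<star> b \<star> a)" using S ab(1,2) by (simp add: assoc closed)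
  then have "x \<star> y \<star> (b \<star> a) = e" using ab left_identity by simp
  then show "x \<star> y \<in> up e"
    using S ab closed unfolding up_def below_def by blast
qed

text \<open>
  With \<open>a\<close> inverse to \<open>x \<star> e\<close>, the element \<open>y \<star> a \<star> x\<close> is \<open>\<L>\<close>-related to \<open>x\<close> and \<open>\<R>\<close>-related to \<open>y\<close>.
\<close>

lemma up_related:
  assumes x: "x \<in> up e" and y: "y \<in> up e"
  shows "(x, y) \<in> green_D S f"
proof -
  obtain a where a: "a \<in> S" "a \<star> (x \<star> e) = e" "x \<star> a = e"
    using x unfolding up_iff by blast
  obtain b where b: "b \<in> S" "b \<star> e = b" "b \<star> (y \<star> e) = e" "y \<star> b = e"
    using y unfolding up_iff by blast
  have S: "x \<in> S" "y \<in> S" using x y by (auto simp: up_iff)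
  let ?z = "y \<star> a \<star> x"
  \<comment> \<open>Only \<open>b \<star> (y \<star> e) = e\<close> is known, so \<open>e\<close> is
    inserted in front of \<open>z\<close> to expose it.\<close>
  have be: "b \<star> y \<star> z = z" if "z \<in> S" for z
  proof -
    have "b \<star> y \<star> (e \<star> z) = b \<star> (y \<star> e) \<star> z"
      using b(1) S that by (simp add: assoc closed e_closed left_identity)
    then show ?thesis using b(3) that left_identity by simp
  qed
  have "x \<star> b \<star> ?z = x \<star> (b \<star> y \<star> (a \<star> x))"
    using S a(1) b(1) by (simp add: assoc closed)
  also have "\<dots> = x \<star> a \<star> x" using be[of "a \<star> x"] S a(1) by (simp add: assoc closed)
  also have "\<dots> = x" using a(3) left_identity S by simp
  finally have "x = x \<star> b \<star> ?z" by simp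
  then have L: "(x, ?z) \<in> green_L S f"
    using S a b closed unfolding green_L_iff by blast
  \<comment> \<open>The same insertion of \<open>e\<close>, now to expose
    \<open>a \<star> (x \<star> e) = e\<close>.\<close>
  have "?z \<star> (e \<star> y') = y \<star> (a \<star> (x \<star> e)) \<star> y'" if "y' \<in> S" for y'
    using S a(1) that by (simp add: assoc closed e_closed left_identity)
  then have "?z \<star> (b \<star> y) = y \<star> e \<star> (b \<star> y)"
    using a(2) b(1) S closed left_identity by metis
  also have "\<dots> = y \<star> b \<star> y" using S b(1) by (simp add: assoc closed e_closed left_identity)
  also have "\<dots> = y" using b(4) left_identity S by simp
  finally have "y = ?z \<star> (b \<star> y)" by simp
  moreover have "?z = y \<star> (a \<star> x)" using S a(1) by (simp add: assoc)
  ultimately have R: "(?z, y) \<in> green_R S f"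
    using S a b closed unfolding green_R_iff by metis
  show ?thesis unfolding green_D_def using L R by blast
qed

end

section \<open>Rank and factorizations\<close>

text \<open>Each column of \<open>A * B\<close> is \<open>A\<close> applied to a column of
  \<open>B\<close>, so the column space shrinks.\<close>

lemma rank_mult_left:
  fixes A B :: "'a::field mat"
  assumes A: "A \<in> carrier_mat m k" and B: "B \<in> carrier_mat k n"
  shows "vec_space.rank m (A * B) \<le> vec_space.rank m A"
proof -
  interpret vec_space "TYPE('a)" m .
  have AB: "A * B \<in> carrier_mat m n" using A B by simp
  have cA: "set (cols A) \<subseteq> carrier_vec m" and cAB: "set (cols (A * B)) \<subseteq> carrier_vec m"
    using cols_dim[of A] cols_dim[of "A * B"] A AB by auto
  have "set (cols (A * B)) \<subseteq> span (set (cols A))"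
  proof
    fix v assume "v \<in> set (cols (A * B))"
    then obtain j where "j < n" "v = col (A * B) j"
      using AB by (auto simp: cols_def)
    then have "v = A *\<^sub>v col B j" "col B j \<in> carrier_vec k" using A B by auto
    then have "v \<in> col_space A" using A by (subst col_space_eq[OF A]) auto
    then show "v \<in> span (set (cols A))" by (simp add: col_space_def)
  qed
  then have "span (set (cols (A * B))) \<subseteq> span (set (cols A))"
    using span_subsetI[OF cA] by blast
  then have "subspace class_ring (span (set (cols (A * B)))) (span_vs (set (cols A)))"
    using nested_subspaces span_is_subspace cA cAB by auto
  then show ?thesis
    unfolding rank_def
    using vectorspace.subspace_dim[OF subspace_is_vs[OF span_is_subspace]] cA
      fin_dim_span_cols[OF A] fin_dim_span_cols[OF AB] by auto
qed

text \<open>Rank factorization: \<open>A\<close> holds a maximal independent set of columns of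
  \<open>X\<close>, and \<open>B\<close> holds coefficients expressing every column of
  \<open>X\<close> through them.\<close>

lemma rank_le_iff_factorization:
  fixes X :: "'a::field mat"
  assumes X: "X \<in> carrier_mat m n"
  shows "vec_space.rank m X \<le> k \<longleftrightarrow>
    (\<exists>A\<in>carrier_mat m k. \<exists>B\<in>carrier_mat k n. X = A * B)"
proof
  assume "\<exists>A\<in>carrier_mat m k. \<exists>B\<in>carrier_mat k n. X = A * B"
  then obtain A B where A: "A \<in> carrier_mat m k" and B: "B \<in> carrier_mat k n" and "X = A * B"
    by blast
  then show "vec_space.rank m X \<le> k"
    using rank_mult_left[OF A B] vec_space.rank_le_nc[OF A] by simp
next
  interpret vec_space "TYPE('a)" m .
  assume le: "rank X \<le> k"
  obtain T where T: "maximal T (\<lambda>T. T \<subseteq> set (cols X) \<and> lin_indpt T)"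
    using maximal_exists[of "\<lambda>T. T \<subseteq> set (cols X) \<and> lin_indpt T" "card (set (cols X))" "{}"]
    by (meson List.finite_set card_mono empty_iff empty_subsetI finite_lin_indpt2 rev_finite_subset)
  have cX: "set (cols X) \<subseteq> carrier_vec m" using cols_dim[of X] X by auto
  have T1: "T \<subseteq> set (cols X)" "lin_indpt T" using T by (auto simp: maximal_def)
  have "finite T" using T1(1) finite_subset by blast
  then obtain ts where ts: "set ts = T" "distinct ts" using finite_distinct_list by blast
  have "length ts \<le> k" using le rank_card_indpt[OF X T] ts distinct_card by fastforce
  \<comment> \<open>Zero columns bring the inner dimension to exactly \<open>k\<close> and keep the
    span of \<open>T\<close> inside the column space.\<close>
  define bs where "bs = ts @ replicate (k - length ts) (0\<^sub>v m)"
  have len: "length bs = k" using \<open>length ts \<le> k\<close> by (simp add: bs_def)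
  have bs: "set bs \<subseteq> carrier_vec m" using ts T1 cX by (auto simp: bs_def)
  define A where "A = mat_of_cols m bs"
  have A: "A \<in> carrier_mat m k" using len by (auto simp: A_def)
  \<comment> \<open>A column outside the span could be adjoined to \<open>T\<close>, against
    maximality.\<close>
  have spanT: "v \<in> span T" if v: "v \<in> set (cols X)" for v
  proof (rule ccontr)
    assume nv: "v \<notin> span T"
    have Tc: "T \<subseteq> carrier_vec m" using T1 cX by blast
    then have "v \<notin> T" using nv span_mem by blast
    moreover have "lin_indpt (insert v T)"
      using lin_dep_iff_in_span[of T v] nv v T1 cX Tc \<open>v \<notin> T\<close> by auto
    ultimately show False using T v T1(1) unfolding maximal_def by blast
  qed
  have colA: "span T \<subseteq> col_space A"
  proof -
    have "span T \<subseteq> span (set bs)" using ts by (intro span_is_monotone) (auto simp: bs_def)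
    then show ?thesis using bs by (simp add: col_space_def A_def)
  qed
  have "\<forall>j<n. \<exists>w\<in>carrier_vec k. A *\<^sub>v w = col X j"
  proof (intro allI impI)
    fix j assume "j < n"
    then have "col X j \<in> set (cols X)" using X by (auto simp: cols_def)
    then have "col X j \<in> col_space A" using spanT colA by blast
    then show "\<exists>w\<in>carrier_vec k. A *\<^sub>v w = col X j" unfolding col_space_eq[OF A] using A by auto
  qed
  then obtain w where w: "\<And>j. j < n \<Longrightarrow> w j \<in> carrier_vec k \<and> A *\<^sub>v w j = col X j"
    by metis
  define B where "B = mat_of_cols k (map w [0..<n])"
  have B: "B \<in> carrier_mat k n" by (auto simp: B_def)
  have "X = A * B"
  proof (rule mat_col_eqI)
    fix j assume "j < dim_col (A * B)"
    then have j: "j < n" using B by simp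
    then have "col B j = w j" using w by (simp add: B_def)
    then show "col X j = col (A * B) j" using w[OF j] col_mult2[OF A B j] by simp
  qed (use A B X in auto)
  then show "\<exists>A\<in>carrier_mat m k. \<exists>B\<in>carrier_mat k n. X = A * B" using A B by blast
qed

text \<open>A factorization \<open>B = C * D\<close> through the rank of \<open>B\<close> gives
  \<open>A * B = (A * C) * D\<close> with the same inner dimension.\<close>

lemma rank_mult_right:
  fixes A B :: "'a::field mat"
  assumes A: "A \<in> carrier_mat m k" and B: "B \<in> carrier_mat k n"
  shows "vec_space.rank m (A * B) \<le> vec_space.rank k B"
proof -
  obtain C D where CD: "C \<in> carrier_mat k (vec_space.rank k B)" "D \<in> carrier_mat (vec_space.rank k B) n"
    "B = C * D"
    using rank_le_iff_factorization[OF B, of "vec_space.rank k B"] by blast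
  then have "A * B = A * C * D" "A * C \<in> carrier_mat m (vec_space.rank k B)"
    using A by (auto simp: assoc_mult_mat)
  then show ?thesis
    using rank_le_iff_factorization[of "A * B" m n] A B CD(2) mult_carrier_mat by blast
qed

lemma rank_le_nr:
  fixes X :: "'a::field mat"
  assumes "X \<in> carrier_mat m n"
  shows "vec_space.rank m X \<le> m"
proof -
  have "X = 1\<^sub>m m * X" using assms by simp
  then show ?thesis using rank_le_iff_factorization[OF assms] assms one_carrier_mat by blast
qed

lemma full_rank_obtain_inverse:
  fixes A :: "'a::field mat"
  assumes A: "A \<in> carrier_mat n n" and "n \<le> vec_space.rank n A"
  obtains B where "B \<in> carrier_mat n n" "A * B = 1\<^sub>m n" "B * A = 1\<^sub>m n"
proof -
  have "vec_space.rank n A = n" using assms rank_le_nr[OF A] by simp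
  then have "det A \<noteq> 0" using vec_space.det_rank_iff[OF A] by blast
  then have "A \<in> Units (ring_mat TYPE('a) n ())" by (rule det_non_zero_imp_unit[OF A])
  then show ?thesis using that by (auto simp: Units_def ring_mat_def)
qed

section \<open>Partial identity matrices\<close>

lemma J_mat_index:
  "r \<le> min n m \<Longrightarrow> i < n \<Longrightarrow> j < m \<Longrightarrow> J_mat n m r $$ (i, j) = (if i = j \<and> i < r then 1 else 0)"
  by (auto simp: J_mat_def)

lemma J_mat_dim [simp]:
  "r \<le> n \<Longrightarrow> dim_row (J_mat n m r) = n" "r \<le> m \<Longrightarrow> dim_col (J_mat n m r) = m"
  by (auto simp: J_mat_def)

lemma J_mat_full: "J_mat n n n = 1\<^sub>m n"
  by (rule eq_matI) (auto simp: J_mat_index)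

text \<open>In the sum for entry \<open>(i, j)\<close> only \<open>k = i\<close> can contribute. The
  rule reduces products such as \<open>E J\<close> or \<open>P J Y J Q\<close> to a single partial
  identity by rewriting.\<close>

lemma J_mat_mult:
  assumes "s \<le> min a b" "t \<le> min b c"
  shows "J_mat a b s * J_mat b c t = (J_mat a c (min s t) :: 'a::field mat)"
proof (rule eq_matI)
  have st: "min s t \<le> min a c" using assms by auto
  fix i j assume "i < dim_row (J_mat a c (min s t) :: 'a mat)"
    "j < dim_col (J_mat a c (min s t) :: 'a mat)"
  then have ij: "i < a" "j < c" using assms by auto
  have "(J_mat a b s * J_mat b c t) $$ (i, j)
      = (\<Sum>k = 0..<b. J_mat a b s $$ (i, k) * (J_mat b c t :: 'a mat) $$ (k, j))"
    using ij assms by (simp add: scalar_prod_def)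
  also have "\<dots> = (\<Sum>k = 0..<b. if k = i then (if i < s \<and> i = j \<and> i < t then 1 else 0) else 0)"
    using ij assms by (intro sum.cong) (auto simp: J_mat_index)
  also have "\<dots> = J_mat a c (min s t) $$ (i, j)"
    unfolding J_mat_index[OF st ij] using ij assms by auto
  finally show "(J_mat a b s * J_mat b c t) $$ (i, j) = (J_mat a c (min s t) :: 'a mat) $$ (i, j)" .
qed (use assms in auto)

text \<open>The upper bound factors the matrix through dimension \<open>s\<close>; the lower bound
  cuts it down to the identity of size \<open>s\<close>, and multiplication cannot raise
  rank.\<close>

lemma rank_J_mat:
  assumes s: "s \<le> min m n"
  shows "vec_space.rank m (J_mat m n s :: 'a::field mat) = s"
proof (rule antisym)
  let ?J = "\<lambda>a b. J_mat a b s :: 'a mat"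
  have c: "?J m n \<in> carrier_mat m n" "?J m s \<in> carrier_mat m s" "?J s n \<in> carrier_mat s n"
    "?J s m \<in> carrier_mat s m" "?J n s \<in> carrier_mat n s"
    using s by (auto intro!: J_mat_carrier)
  have "?J m n = ?J m s * ?J s n" using s by (simp add: J_mat_mult)
  then show "vec_space.rank m (?J m n) \<le> s"
    using rank_le_iff_factorization[OF c(1)] c by blast
  have "det (1\<^sub>m s :: 'a mat) \<noteq> 0" by simp
  then have "s = vec_space.rank s (1\<^sub>m s :: 'a mat)"
    using vec_space.det_rank_iff[of "1\<^sub>m s :: 'a mat" s] by simp
  also have "1\<^sub>m s = ?J s m * ?J m n * ?J n s"
    using s by (simp add: J_mat_mult J_mat_full)
  also have "vec_space.rank s (?J s m * ?J m n * ?J n s) \<le> vec_space.rank s (?J s m * ?J m n)"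
    using rank_mult_left[of "?J s m * ?J m n" s n "?J n s" s] c by simp
  also have "\<dots> \<le> vec_space.rank m (?J m n)"
    using rank_mult_right[of "?J s m" s m "?J m n" n] c by simp
  finally show "s \<le> vec_space.rank m (?J m n)" .
qed

text \<open>Side conditions on dimensions, instead of carriers with free size variables, let
  associativity serve as a rewrite rule.\<close>

lemma assoc_mult_mat_dim:
  fixes A B C :: "'a::semiring_0 mat"
  assumes "dim_col A = dim_row B" "dim_col B = dim_row C"
  shows "A * B * C = A * (B * C)"
  by (rule assoc_mult_mat[of _ "dim_row A" "dim_row B" _ "dim_row C" _ "dim_col C"])
    (rule carrier_matI; simp only: assms)+

section \<open>The sandwich semigroup\<close>

theorem proposition4p10:
  fixes m n r :: nat
    and M :: "'a::field mat set"
    and mul :: "'a mat \<Rightarrow> 'a mat \<Rightarrow> 'a mat"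
  defines "M \<equiv> carrier_mat m n"
    and "mul \<equiv> star m n r"
  assumes "m \<ge> 1" and "n \<ge> 1" and "r \<le> min m n"
  shows "(r = min m n \<longrightarrow>
            {C. maximal_D_class M mul C} = {{X \<in> Reg M mul. vec_space.rank m X = r}} \<and>
            subsemigroup M mul {X \<in> Reg M mul. vec_space.rank m X = r}) \<and>
         (r < min m n \<longrightarrow>
            {C. maximal_D_class M mul C} = {D_class M mul X | X. X \<in> M \<and> vec_space.rank m X > r} \<and>
            (\<forall>X\<in>M. vec_space.rank m X > r \<longrightarrow> D_class M mul X = {X}))"
proof -
  note r = assms(5)
  let ?M = "carrier_mat m n :: 'a mat set" and ?D = "D_class (carrier_mat m n) (star m n r) :: 'a mat \<Rightarrow> _"
  let ?J = "J_mat n m r :: 'a mat" and ?E = "J_mat m n r :: 'a mat"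
  interpret semigroup_on ?M "star m n r"
    using r by unfold_locales (auto simp: star_closed star_assoc)
  have J_carrier [simp]: "?J \<in> carrier_mat n m" and E_carrier [simp]: "?E \<in> ?M"
    using r J_mat_carrier by auto
  have [simp]: "dim_row ?J = n" "dim_col ?J = m" "dim_row ?E = m" "dim_col ?E = n"
    using r by auto

  \<comment> \<open>Rank and the order of the sandwich semigroup\<close>
  have rank_star_le: "vec_space.rank m (star m n r X Y) \<le> r"
    if "X \<in> ?M" "Y \<in> ?M" for X Y
  proof -
    have "X * ?J \<in> carrier_mat m m" using that by (intro carrier_matI) auto
    then have "vec_space.rank m (X * ?J * Y) \<le> vec_space.rank m (X * ?J)"
      using that(2) by (rule rank_mult_left)
    also have "\<dots> \<le> vec_space.rank n (?J :: 'a mat)"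
      using that(1) J_carrier by (rule rank_mult_right)
    finally show ?thesis using r rank_J_mat[of r n m, where 'a = 'a] by (simp add: star_def)
  qed

  have rank_star_le_left: "vec_space.rank m (star m n r X Y) \<le> vec_space.rank m X"
    if "X \<in> ?M" "Y \<in> ?M" for X Y
  proof -
    have "star m n r X Y = X * (?J * Y)"
      using that by (simp add: star_def assoc_mult_mat_dim)
    moreover have "?J * Y \<in> carrier_mat n n" using that by (intro carrier_matI) auto
    ultimately show ?thesis using rank_mult_left[OF that(1)] by simp
  qed

  have rank_star_le_right: "vec_space.rank m (star m n r X Y) \<le> vec_space.rank m Y"
    if "X \<in> ?M" "Y \<in> ?M" for X Y
  proof -
    have "X * ?J \<in> carrier_mat m m" using that by (intro carrier_matI) auto
    then show ?thesis unfolding star_def using that(2) by (rule rank_mult_right)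
  qed

  have rank_mono: "vec_space.rank m X \<le> vec_space.rank m Y"
    if "below ?M (star m n r) X Y" "Y \<in> ?M" for X Y
    using that(1) unfolding below_def
  proof (elim disjE bexE)
    fix U V :: "'a mat" assume UV: "U \<in> ?M" "V \<in> ?M" and X: "X = star m n r (star m n r U Y) V"
    have "vec_space.rank m X \<le> vec_space.rank m (star m n r U Y)"
      unfolding X by (rule rank_star_le_left[OF star_closed[OF UV(1) that(2)] UV(2)])
    also have "\<dots> \<le> vec_space.rank m Y" by (rule rank_star_le_right[OF UV(1) that(2)])
    finally show ?thesis .
  qed (simp_all add: rank_star_le_left rank_star_le_right that(2))

  have below_eq_if_high_rank: "Y = X"
    if XY: "below ?M (star m n r) X Y" "Y \<in> ?M" "r < vec_space.rank m X" for X Y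
  proof -
    have "\<not> r < vec_space.rank m (star m n r U V)" if "U \<in> ?M" "V \<in> ?M" for U V :: "'a mat"
      using rank_star_le[OF that] by simp
    then show ?thesis
      using XY star_closed unfolding below_def by metis
  qed

  have low_rank_below: "below ?M (star m n r) X (J_mat m n s)"
    if X: "X \<in> ?M" and rank: "vec_space.rank m X \<le> r" and s: "r \<le> s" "s \<le> min m n" for X s
  proof -
    obtain A B where A: "A \<in> carrier_mat m r" and B: "B \<in> carrier_mat r n" and AB: "X = A * B"
      using rank rank_le_iff_factorization[OF X] by blast
    \<comment> \<open>\<open>P\<close> and \<open>Q\<close> are sized so that
      \<open>P J Y J Q\<close> is the identity of size \<open>r\<close>, which is then inserted
      between \<open>A\<close> and \<open>B\<close>; this works for every \<open>s\<close> from
      \<open>r\<close> to \<open>min m n\<close>.\<close>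
    let ?P = "J_mat r n r :: 'a mat" and ?Q = "J_mat m r r :: 'a mat" and ?Y = "J_mat m n s :: 'a mat"
    have c: "?P \<in> carrier_mat r n" "?Q \<in> carrier_mat m r" "?Y \<in> carrier_mat m n"
      using r s by (auto intro!: J_mat_carrier)
    have "?P * ?J * ?Y * ?J * ?Q = 1\<^sub>m r"
      using r s by (simp add: J_mat_mult J_mat_full)
    then have "A * B = A * (?P * ?J * ?Y * ?J * ?Q) * B" using A by simp
    also have "\<dots> = star m n r (star m n r (A * ?P) ?Y) (?Q * B)"
      using A B c by (simp add: star_def assoc_mult_mat_dim)
    finally have "X = star m n r (star m n r (A * ?P) ?Y) (?Q * B)" using AB by simp
    moreover have "A * ?P \<in> ?M" "?Q * B \<in> ?M" using A B c by auto
    ultimately show ?thesis unfolding below_def by blast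
  qed

  \<comment> \<open>One-sided identities for full \<open>r\<close>\<close>
  have left_identity_star: "left_identity_semigroup ?M (star m n r) ?E" if "r = m"
  proof -
    have EJ: "?E * ?J = (1\<^sub>m m :: 'a mat)" using r that by (simp add: J_mat_mult J_mat_full)
    have star_E: "star m n r (star m n r a ?E) (star m n r b ?E) = a * ?J * (b * ?J) * ?E"
      if "a \<in> ?M" "b \<in> ?M" for a b :: "'a mat"
    proof -
      have "star m n r (star m n r a ?E) (star m n r b ?E) = a * ?J * (?E * ?J) * (b * ?J * ?E)"
        using that by (simp add: star_def assoc_mult_mat_dim)
      also have "\<dots> = a * ?J * (b * ?J) * ?E"
        unfolding EJ using that by (simp add: assoc_mult_mat_dim)
      finally show ?thesis .
    qed
    show ?thesis
    proof (intro left_identity_semigroup.intro semigroup_on_axioms left_identity_semigroup_axioms.intro)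
      fix a b :: "'a mat"
      assume ab: "a \<in> ?M" "b \<in> ?M" "star m n r (star m n r a ?E) (star m n r b ?E) = ?E"
      have aJ: "a * ?J \<in> carrier_mat m m" and bJ: "b * ?J \<in> carrier_mat m m" using ab by auto
      \<comment> \<open>Multiplying by \<open>J\<close> on the right cancels \<open>E\<close>,
        leaving square matrices over a field, where one-sided inverses are two-sided.\<close>
      have "a * ?J * (b * ?J) * ?E * ?J = a * ?J * (b * ?J) * (?E * ?J)"
        using ab by (simp add: assoc_mult_mat_dim)
      then have "a * ?J * (b * ?J) = 1\<^sub>m m" using ab star_E[of a b] EJ aJ bJ by simp
      then have "b * ?J * (a * ?J) = 1\<^sub>m m" using mat_mult_left_right_inverse[OF aJ bJ] by simp
      then show "star m n r (star m n r b ?E) (star m n r a ?E) = ?E"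
        using star_E[of b a] ab by simp
    qed (use EJ in \<open>auto simp: star_def\<close>)
  qed

  have right_identity_star:
    "left_identity_semigroup ?M (\<lambda>X Y. star m n r Y X) ?E" if "r = n"
  proof -
    have JE: "?J * ?E = (1\<^sub>m n :: 'a mat)" using r that by (simp add: J_mat_mult J_mat_full)
    \<comment> \<open>Under the reversed product the locale's
      \<open>a \<star> e \<star> (b \<star> e)\<close> reads with \<open>b\<close> first and
      \<open>E\<close> on the left.\<close>
    have star_E: "star m n r (star m n r ?E b) (star m n r ?E a) = ?E * (?J * b * (?J * a))"
      if "a \<in> ?M" "b \<in> ?M" for a b :: "'a mat"
    proof -
      have "star m n r (star m n r ?E b) (star m n r ?E a) = ?E * (?J * b * (?J * ?E) * (?J * a))"
        using that by (simp add: star_def assoc_mult_mat_dim)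
      also have "\<dots> = ?E * (?J * b * (?J * a))"
        unfolding JE using that by (simp add: assoc_mult_mat_dim)
      finally show ?thesis .
    qed
    show ?thesis
    proof (intro left_identity_semigroup.intro left_identity_semigroup_axioms.intro
        opposite)
      fix a b :: "'a mat"
      assume ab: "a \<in> ?M" "b \<in> ?M" "star m n r (star m n r ?E b) (star m n r ?E a) = ?E"
      have Ja: "?J * a \<in> carrier_mat n n" and Jb: "?J * b \<in> carrier_mat n n" using ab by auto
      have "?J * (?E * (?J * b * (?J * a))) = ?J * ?E * (?J * b * (?J * a))"
        using ab by (simp add: assoc_mult_mat_dim)
      then have "?J * b * (?J * a) = 1\<^sub>m n" using ab star_E[of a b] JE Ja Jb by simp
      then have "?J * a * (?J * b) = 1\<^sub>m n" using mat_mult_left_right_inverse[OF Jb Ja] by simp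
      then show "star m n r (star m n r ?E a) (star m n r ?E b) = ?E"
        using star_E[of b a] ab by simp
    qed (use JE in \<open>auto simp: star_def assoc_mult_mat_dim\<close>)
  qed

  \<comment> \<open>If \<open>X = X \<star> Y \<star> X\<close> has rank \<open>m\<close> (rank \<open>n\<close>), then the square matrix \<open>X J Y J\<close> (\<open>J Y J X\<close>)
    has full rank and is therefore invertible.\<close>
  have below_regular_full_rank: "below ?M (star m n r) ?E X"
    if full: "r = min m n" and X: "X \<in> Reg ?M (star m n r)" and rank: "vec_space.rank m X = r" for X
  proof -
    have XM: "X \<in> ?M" and "\<exists>Y\<in>?M. X = star m n r (star m n r X Y) X"
      using X unfolding Reg_def by blast+
    then obtain Y where Y: "Y \<in> ?M" "star m n r (star m n r X Y) X = X" by metis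
    show ?thesis
    proof (cases "r = m")
      case True
      let ?B = "X * ?J * Y * ?J"
      have B: "?B \<in> carrier_mat m m" using Y(1) XM by (intro carrier_matI) auto
      have "?B * X = X" using Y(2) by (simp add: star_def)
      then have "m \<le> vec_space.rank m ?B"
        using rank_mult_left[OF B XM] rank True by simp
      then obtain W where W: "W \<in> carrier_mat m m" "?B * W = 1\<^sub>m m"
        by (rule full_rank_obtain_inverse[OF B])
      \<comment> \<open>The right factor is chosen so that \<open>X J Y J\<close> meets its inverse
        \<open>W\<close> and only \<open>E\<close> remains.\<close>
      have "star m n r X (Y * ?J * W * ?E) = ?B * W * ?E"
        using Y(1) XM W(1) by (simp add: star_def assoc_mult_mat_dim)
      then have "?E = star m n r X (Y * ?J * W * ?E)" using W by simp
      moreover have "Y * ?J * W * ?E \<in> ?M" using Y(1) W by (intro carrier_matI) auto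
      ultimately show ?thesis unfolding below_def by blast
    next
      case False
      then have rn: "r = n" using full by (simp add: min_def split: if_splits)
      let ?C = "?J * (Y * (?J * X))"
      have C: "?C \<in> carrier_mat n n" using Y(1) XM by (intro carrier_matI) auto
      have "star m n r (star m n r X Y) X = X * ?C"
        using Y(1) XM by (simp add: star_def assoc_mult_mat_dim)
      then have "X * ?C = X" using Y(2) by simp
      then have "n \<le> vec_space.rank n ?C"
        using rank_mult_right[OF XM C] rank rn by simp
      then obtain W where W: "W \<in> carrier_mat n n" "W * ?C = 1\<^sub>m n"
        by (rule full_rank_obtain_inverse[OF C])
      have "star m n r (?E * W * ?J * Y) X = ?E * (W * ?C)"
        using Y(1) XM W(1) by (simp add: star_def assoc_mult_mat_dim)
      then have "?E = star m n r (?E * W * ?J * Y) X" using W by simp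
      moreover have "?E * W * ?J * Y \<in> ?M" using Y(1) W by (intro carrier_matI) auto
      ultimately show ?thesis unfolding below_def by blast
    qed
  qed

  have up_E: "(\<forall>X\<in>?M. below ?M (star m n r) X ?E) \<and>
      (\<forall>X\<in>up ?E. \<forall>Y\<in>up ?E. (X, Y) \<in> green_D ?M (star m n r)) \<and> up ?E \<subseteq> Reg ?M (star m n r) \<and>
      (\<forall>X\<in>up ?E. \<forall>Y\<in>up ?E. star m n r X Y \<in> up ?E)" if full: "r = min m n"
  proof (cases "r = m")
    case True
    interpret L: left_identity_semigroup ?M "star m n r" ?E
      by (rule left_identity_star[OF True])
    show ?thesis
      using L.below_left_identity L.up_related L.up_regular L.up_closed by blast
  next
    case False
    then have "r = n" using full by (simp add: min_def split: if_splits)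
    interpret L: left_identity_semigroup ?M "\<lambda>X Y. star m n r Y X" ?E
      by (rule right_identity_star[OF \<open>r = n\<close>])
    \<comment> \<open>\<open>below\<close> allows multiplication on either side, so reversing the
      product leaves the filter unchanged.\<close>
    have up: "L.up ?E = up ?E"
      by (auto simp: L.up_def up_def below_opposite)
    have "(X, Y) \<in> green_D ?M (star m n r)" "star m n r X Y \<in> up ?E"
      if "X \<in> up ?E" "Y \<in> up ?E" for X Y
      using L.up_related[of Y X] L.up_closed[of Y X] that
      unfolding up green_D_opposite by simp_all
    moreover have "up ?E \<subseteq> Reg ?M (star m n r)"
      using L.up_regular unfolding up Reg_opposite .
    moreover have "below ?M (star m n r) X ?E" if "X \<in> ?M" for X
      using L.below_left_identity[OF that] below_opposite[OF E_carrier] by simp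
    ultimately show ?thesis by blast
  qed

  have up_eq: "{X \<in> Reg ?M (star m n r). vec_space.rank m X = r} = up ?E" (is "?R = _")
    if full: "r = min m n"
  proof
    show "?R \<subseteq> up ?E"
      using below_regular_full_rank[OF full] by (auto simp: up_def Reg_def)
    show "up ?E \<subseteq> ?R"
    proof
      fix X assume X: "X \<in> up ?E"
      then have XM: "X \<in> ?M" and "below ?M (star m n r) ?E X" by (auto simp: up_def)
      \<comment> \<open>Lying above \<open>E\<close> forces rank at least \<open>r\<close>, while
        \<open>r = min m n\<close> is the largest possible rank.\<close>
      then have "r \<le> vec_space.rank m X"
        using rank_mono[of ?E X] rank_J_mat[OF r, where 'a = 'a] by simp
      moreover have "vec_space.rank m X \<le> r"
        using rank_le_nr[OF XM] vec_space.rank_le_nc[OF XM] full by simp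
      ultimately show "X \<in> ?R" using X up_E[OF full] by auto
    qed
  qed

  \<comment> \<open>Rank of maximal elements for small \<open>r\<close>\<close>
  have high: "r < vec_space.rank m X"
    if less: "r < min m n" and X: "X \<in> ?M" and max: "maximal_D_class ?M (star m n r) (?D X)" for X
  proof (rule ccontr)
    assume "\<not> r < vec_space.rank m X"
    then have low: "vec_space.rank m X \<le> r" by simp
    let ?Y = "J_mat m n (Suc r) :: 'a mat"
    have Y: "?Y \<in> ?M" "vec_space.rank m ?Y = Suc r"
      using less J_mat_carrier[of "Suc r" n m] rank_J_mat[of "Suc r" m n] by auto
    have "below ?M (star m n r) X ?Y"
      using low_rank_below[OF X low, of "Suc r"] less by simp
    \<comment> \<open>Maximality would put \<open>Y\<close>, of rank \<open>r + 1\<close>, back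
      below \<open>X\<close>, against monotonicity of rank.\<close>
    then have "below ?M (star m n r) ?Y X" by (rule below_of_maximal[OF max X Y(1)])
    then have "vec_space.rank m ?Y \<le> vec_space.rank m X" using X by (rule rank_mono)
    then show False using low Y by simp
  qed

  \<comment> \<open>Conclusion in both cases\<close>
  show ?thesis
    unfolding M_def mul_def
  proof (intro conjI impI)
    assume full: "r = min m n"
    show "{C. maximal_D_class ?M (star m n r) C} = {{X \<in> Reg ?M (star m n r). vec_space.rank m X = r}}"
      unfolding up_eq[OF full]
      by (rule unique_maximal_D_class[OF E_carrier]) (use up_E[OF full] in simp_all)
    have "?E \<in> up ?E" by (simp add: up_def below_refl)
    then have "up ?E \<noteq> {}" by blast
    moreover have "up ?E \<subseteq> ?M" by (auto simp: up_def)
    ultimately show "subsemigroup ?M (star m n r) {X \<in> Reg ?M (star m n r). vec_space.rank m X = r}"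
      unfolding up_eq[OF full] subsemigroup_def using up_E[OF full] by simp
  next
    assume less: "r < min m n"
    show "\<forall>X\<in>?M. r < vec_space.rank m X \<longrightarrow> ?D X = {X}"
      using D_class_eq_singleton below_eq_if_high_rank by blast
    show "{C. maximal_D_class ?M (star m n r) C} = {?D X | X. X \<in> ?M \<and> r < vec_space.rank m X}"
    proof (rule equalityI; rule subsetI)
      fix C assume C: "C \<in> {C. maximal_D_class ?M (star m n r) C}"
      then obtain X where "X \<in> ?M" "C = ?D X" unfolding maximal_iff by blast
      then show "C \<in> {?D X | X. X \<in> ?M \<and> r < vec_space.rank m X}" using high[OF less] C by blast
    next
      fix C assume "C \<in> {?D X | X. X \<in> ?M \<and> r < vec_space.rank m X}"
      then obtain X where "X \<in> ?M" "r < vec_space.rank m X" "C = ?D X" by blast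
      then show "C \<in> {C. maximal_D_class ?M (star m n r) C}"
        using maximal_D_class_of_singleton[of X] below_eq_if_high_rank by blast
    qed
  qed
qed

end
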